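(* Let $n\in\mathbb{N}$ and $\alpha\in[0,1]$. Then $$C_{n,\alpha}=\max_{r\ge 1+\frac1n}\frac{\ln|E_n(r)|}{r^{n+\alpha}}$$ (where $r$ ranges over real numbers). Moreover, the mapping $[0,1]\ni\alpha\mapsto C_{n,\alpha}$ is monotone decreasing and convex.
   Context: Here $\mathbb{N}=\{1,2,3,\dots\}$. For $n\in\mathbb{N}$ the Weierstrass primary factor is $E_n(z):=(1-z)\exp\left(\sum_{k=1}^{n}\frac{z^k}{k}\right)$, $z\in\mathbb{C}$. For $n\in\mathbb{N}$ and $\alpha\in[0,1]$, $$C_{n,\alpha}:=\sup_{z\in\mathbb{C}\setminus\{0,1\}}\frac{\ln|E_n(z)|}{|z|^{n+\alpha}}.$$ *)

theory Defs
  imports "HOL-Complex_Analysis.Weierstrass_Factorization"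
begin

definition growth_ratio :: "nat \<Rightarrow> real \<Rightarrow> complex \<Rightarrow> real" where
  "growth_ratio n \<alpha> z = ln (norm (weierstrass_factor n z)) / norm z powr (real n + \<alpha>)"

(* A supremum of type real is only meaningful for a set that is bounded above; statements about
   this constant should therefore come with bdd_above for the same family. *)
definition growth_const :: "nat \<Rightarrow> real \<Rightarrow> real" where
  "growth_const n \<alpha> = (SUP z \<in> UNIV - {0, 1}. growth_ratio n \<alpha> z)"

end

theory Submission
  imports Defs "HOL-Analysis.Harmonic_Numbers" "HOL-Real_Asymp.Real_Asymp"
begin

text \<open>Write $E = E_n$. The logarithmic derivative of $E$ is $-z^n/(1-z)$. Hence along any ray
$\rho \mapsto \rho e^{i\phi}$ the function $\ln|E|$ grows at rate at most $\rho^n/|1-z|$, with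
equality on the real axis to the right of $1$, and at radius $\rho$ its angular derivative has the
sign of $\sin((n+1)\phi) - \rho\sin(n\phi)$.

Let $r_1 = 1 + 1/n$. If the positive real point dominates the circle of radius $r_1$, then it
dominates every larger circle, because it is the point with the smallest $|1-z|$ and so the one
where the radial growth is largest. It remains to settle the circle of radius $r_1$ and to bound
$\ln|E|$ inside it.

Inside, the dominating point on the circle of radius $\rho$ is the critical point of smallest
angle: $z = r(t) e^{it}$ with $r(t) = \sin((n+1)t)/\sin(nt)$. As $t$ decreases from $\pi/(n+1)$
to $0$, the radius $r(t)$ increases from $0$ to $r_1$. On this curve
$1 - z = -e^{i(n+1)t}/q(t)$ with $q(t) = \sin(nt)/\sin t$, which makes $-z^n/(1-z)$ a positive
multiple of $e^{-it}$: the radial growth of $\ln|E|$ attains the upper bound $\rho^n/|1-z|$. A ray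
at a larger angle stays farther from $1$ than the curve does, so $\ln|E|$ grows at most as fast on
the ray as on the curve; at a smaller angle, $\ln|E|$ increases with the angle up to the curve
(\<open>log_norm_factor_le_crit_value_above\<close>, \<open>log_norm_factor_le_crit_value_below\<close>).

Let $L(t)$ be the value of $\ln|E|$ on the curve. Since $dL = r^n q\,dr$ and $q$ is nondecreasing
in $r$, the quotient $L/r^{n+1}$ is nondecreasing in $r$ as well, so that $\ln|E(z)| \le c\,|z|^{n+1}$ for
$|z| < r_1$, where $c = \ln|E(r_1)|/r_1^{n+1} > 0$ (\<open>log_norm_factor_inner_bound\<close>). By
continuity this gives $|E(z)| \le |E(r_1)|$ on the circle $|z| = r_1$, hence dominance of
the real point beyond it (\<open>log_norm_factor_outer_bound\<close>). Dividing by $|z|^{n+\alpha}$ with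
$\alpha \le 1$, every growth ratio is bounded by one at a real $r \ge r_1$. The maximum over these
$r$ exists because the ratio decreases for large $r$. Finally, for fixed $r > 1$ with
$\ln|E(r)| > 0$ the ratio is a decreasing convex function of $\alpha$, and these two properties
pass to the maximum over $r$.\<close>

section \<open>The logarithmic derivative of a primary factor\<close>

abbreviation log_norm_factor :: "nat \<Rightarrow> complex \<Rightarrow> real" where
  "log_norm_factor n z \<equiv> ln (norm (weierstrass_factor n z))"

lemma weierstrass_factor_has_field_derivative:
  "(weierstrass_factor n has_field_derivative
     - (z ^ n) * exp (\<Sum>k=1..n. z ^ k / of_nat k)) (at z)"
proof -
  have "((\<lambda>z. \<Sum>k=1..n. z ^ k / of_nat k) has_field_derivative (\<Sum>k=1..n. z ^ (k - 1))) (at z)"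
    by (rule derivative_eq_intros refl | simp)+
  also have "(\<Sum>k=1..n. z ^ (k - 1)) = (\<Sum>k<n. z ^ k)"
    by (rule sum.reindex_bij_witness[of _ Suc "\<lambda>k. k - 1"]) auto
  finally have D: "((\<lambda>z. \<Sum>k=1..n. z ^ k / of_nat k) has_field_derivative (\<Sum>k<n. z ^ k)) (at z)" .
  have geo: "(1 - z) * (\<Sum>k<n. z ^ k) = 1 - z ^ n"
    by (simp add: one_diff_power_eq)
  have "((\<lambda>z. (1 - z) * exp (\<Sum>k=1..n. z ^ k / of_nat k)) has_field_derivative
           - 1 * exp (\<Sum>k=1..n. z ^ k / of_nat k) +
           exp (\<Sum>k=1..n. z ^ k / of_nat k) * (\<Sum>k<n. z ^ k) * (1 - z)) (at z)"
    by (intro DERIV_mult DERIV_fun_exp D) (auto intro!: derivative_eq_intros)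
  also have "- 1 * exp (\<Sum>k=1..n. z ^ k / of_nat k) +
           exp (\<Sum>k=1..n. z ^ k / of_nat k) * (\<Sum>k<n. z ^ k) * (1 - z) =
           - (z ^ n) * exp (\<Sum>k=1..n. z ^ k / of_nat k)"
    using arg_cong[OF geo, of "\<lambda>u. exp (\<Sum>k=1..n. z ^ k / of_nat k) * (u - 1)"]
    by (simp add: algebra_simps)
  finally show ?thesis
    unfolding weierstrass_factor_def[abs_def] .
qed

text \<open>Differentiating $\ln|E|$ along a curve avoids choosing a branch of $\ln E$, so that curves may
run anywhere in the plane except through the zero at $1$.\<close>

lemma log_norm_factor_has_real_derivative:
  assumes w: "(w has_vector_derivative w') (at t)" and "w t \<noteq> 1"
  shows "((\<lambda>t. log_norm_factor n (w t)) has_real_derivative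
           Re (- (w t ^ n / (1 - w t)) * w')) (at t)"
proof -
  define S where "S = exp (\<Sum>k=1..n. w t ^ k / of_nat k)"
  define E where "E = weierstrass_factor n (w t)"
  define D where "D = w' * (- (w t ^ n) * S)"
  have E: "E = (1 - w t) * S"
    by (simp add: E_def S_def weierstrass_factor_def)
  have "E \<noteq> 0"
    using assms by (simp add: E_def)
  have "((weierstrass_factor n \<circ> w) has_vector_derivative D) (at t)"
    unfolding D_def S_def
    by (rule field_vector_diff_chain_at[OF w weierstrass_factor_has_field_derivative])
  hence "((\<lambda>t. weierstrass_factor n (w t)) has_derivative (\<lambda>h. h *\<^sub>R D)) (at t)"
    by (simp add: o_def has_vector_derivative_def)
  moreover have "(norm has_derivative (\<lambda>h. h \<bullet> sgn E)) (at (weierstrass_factor n (w t)))"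
    using has_derivative_norm[of E] \<open>E \<noteq> 0\<close> by (simp add: E_def)
  ultimately have "((\<lambda>t. norm (weierstrass_factor n (w t))) has_derivative
           (\<lambda>h. (h *\<^sub>R D) \<bullet> sgn E)) (at t)"
    by (rule has_derivative_compose)
  hence "((\<lambda>t. norm (weierstrass_factor n (w t))) has_real_derivative (D \<bullet> sgn E)) (at t)"
    by (simp add: has_field_derivative_def mult.commute[of _ "D \<bullet> sgn E"])
  from DERIV_chain2[OF DERIV_ln this]
  have "((\<lambda>t. log_norm_factor n (w t)) has_real_derivative (D \<bullet> sgn E) / norm E) (at t)"
    using \<open>E \<noteq> 0\<close> by (simp add: E_def divide_inverse mult.commute)
  also have "(D \<bullet> sgn E) / norm E = (D \<bullet> E) / (norm E)\<^sup>2"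
    by (simp add: sgn_div_norm power2_eq_square divide_inverse)
  also have "\<dots> = Re (D / E)"
    by (simp add: Re_divide inner_complex_def cmod_power2)
  also have "D / E = - (w t ^ n / (1 - w t)) * w'"
    using \<open>w t \<noteq> 1\<close> unfolding D_def E by (simp add: S_def field_simps)
  finally show ?thesis .
qed

section \<open>The curve of dominating critical points\<close>

text \<open>At the point of this radius and angle $t$ the angular derivative of $\ln|E|$ vanishes. At $t = 0$
the quotient is $0/0 = 0$ by convention; the meaningful value there is the limit $1 + 1/n$.\<close>

definition crit_radius :: "nat \<Rightarrow> real \<Rightarrow> real" where
  "crit_radius n t = sin (real (n + 1) * t) / sin (real n * t)"

text \<open>The reciprocal of the distance from $1$ to the point of the critical curve at angle $t$. It is the
value of the Chebyshev polynomial $U_{n-1}$ at $\cos t$.\<close>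

definition crit_slope :: "nat \<Rightarrow> real \<Rightarrow> real" where
  "crit_slope n t = sin (real n * t) / sin t"

definition crit_value :: "nat \<Rightarrow> real \<Rightarrow> real" where
  "crit_value n t = log_norm_factor n (of_real (crit_radius n t) * cis t)"

text \<open>Up to this angle the branch of critical points runs from the threshold radius down to radius $0$.\<close>

abbreviation crit_angles :: "nat \<Rightarrow> real set" where
  "crit_angles n \<equiv> {0<..pi / real (n + 1)}"

lemma cis_has_vector_derivative: "(cis has_vector_derivative \<i> * cis t) (at t)"
  using has_derivative_cis[OF has_derivative_ident, of t UNIV] by (simp add: has_vector_derivative_def)

lemma abs_sin_mult_le: "\<bar>sin (real m * x)\<bar> \<le> real m * \<bar>sin x\<bar>"
proof (induction m)
  case (Suc m)
  have "sin (real (Suc m) * x) = sin (real m * x) * cos x + cos (real m * x) * sin x"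
    by (simp add: algebra_simps sin_add)
  also have "\<bar>\<dots>\<bar> \<le> \<bar>sin (real m * x)\<bar> * \<bar>cos x\<bar> + \<bar>cos (real m * x)\<bar> * \<bar>sin x\<bar>"
    by (metis abs_mult abs_triangle_ineq)
  also have "\<dots> \<le> \<bar>sin (real m * x)\<bar> * 1 + 1 * \<bar>sin x\<bar>"
    by (intro add_mono mult_mono) auto
  also have "\<dots> \<le> real (Suc m) * \<bar>sin x\<bar>"
    using Suc by (simp add: algebra_simps)
  finally show ?case .
qed auto

lemma crit_angle_sin_pos:
  assumes "n \<ge> 1" "t \<in> crit_angles n"
  shows "sin t > 0" "sin (real n * t) > 0" "sin (real (n + 1) * t) \<ge> 0"
    and "real n * t < pi" "t < pi"
proof -
  have *: "real (n + 1) * t \<le> pi" "t > 0"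
    using assms by (auto simp: field_simps)
  hence "real n * t + t \<le> pi" "real n * t > 0" "real n * t \<ge> t"
    using assms by (auto simp: algebra_simps)
  with * show "real n * t < pi" "t < pi"
    by linarith+
  with * \<open>real n * t > 0\<close> show "sin t > 0" "sin (real n * t) > 0" "sin (real (n + 1) * t) \<ge> 0"
    by (auto intro!: sin_gt_zero sin_ge_zero)
qed

lemma crit_radius_nonneg: "n \<ge> 1 \<Longrightarrow> t \<in> crit_angles n \<Longrightarrow> crit_radius n t \<ge> 0"
  using crit_angle_sin_pos[of n t] by (auto simp: crit_radius_def)

lemma crit_slope_pos: "n \<ge> 1 \<Longrightarrow> t \<in> crit_angles n \<Longrightarrow> crit_slope n t > 0"
  using crit_angle_sin_pos[of n t] by (auto simp: crit_slope_def)

lemma crit_radius_end: "crit_radius n (pi / real (n + 1)) = 0"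
  by (simp add: crit_radius_def del: of_nat_Suc)

lemma crit_value_end: "crit_value n (pi / real (n + 1)) = 0"
  unfolding crit_value_def crit_radius_end by simp

text \<open>Product-to-sum turns the numerator of the derivative into
$(\sin((2n+1)t) - (2n+1)\sin t)/2$, and $|\sin(mt)| \le m|\sin t|$.\<close>

lemma crit_radius_has_nonpos_derivative:
  assumes "n \<ge> 1" "t \<in> crit_angles n"
  shows "\<exists>r'\<le>0. (crit_radius n has_real_derivative r') (at t)"
proof -
  note pos = crit_angle_sin_pos[OF assms]
  define a b where "a = real n * t" and "b = real (n + 1) * t"
  have "(crit_radius n has_real_derivative
          (real (n + 1) * cos b * sin a - sin b * (real n * cos a)) / (sin a)\<^sup>2) (at t)"
    unfolding crit_radius_def[abs_def] a_def b_def
    by (rule derivative_eq_intros refl | use pos in \<open>simp add: power2_eq_square\<close>)+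
  moreover have "real (n + 1) * cos b * sin a - sin b * (real n * cos a) \<le> 0"
  proof -
    have "sin (b - a) = sin t"
      by (simp add: a_def b_def algebra_simps)
    hence "real (n + 1) * cos b * sin a - sin b * (real n * cos a)
             = (sin (a + b) - real (2 * n + 1) * sin t) / 2"
      by (simp add: sin_add sin_diff algebra_simps) 
    moreover have "a + b = real (2 * n + 1) * t"
      by (simp add: a_def b_def algebra_simps)
    moreover have "sin (real (2 * n + 1) * t) \<le> real (2 * n + 1) * sin t"
      using abs_sin_mult_le[of "2 * n + 1" t] pos by simp
    ultimately show ?thesis by simp
  qed
  ultimately show ?thesis
    by (intro exI[of _ "(real (n + 1) * cos b * sin a - sin b * (real n * cos a)) / (sin a)\<^sup>2"])
       (auto intro: divide_nonpos_nonneg)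
qed

text \<open>The numerator $n\cos(nt)\sin t - \sin(nt)\cos t$ of the derivative vanishes at $0$ and has itself
the derivative $(1-n^2)\sin(nt)\sin t \le 0$.\<close>

lemma crit_slope_has_nonpos_derivative:
  assumes "n \<ge> 1" "t \<in> crit_angles n"
  shows "\<exists>q'\<le>0. (crit_slope n has_real_derivative q') (at t)"
proof -
  note pos = crit_angle_sin_pos[OF assms]
  define h where "h = (\<lambda>s. real n * cos (real n * s) * sin s - sin (real n * s) * cos s)"
  have "(crit_slope n has_real_derivative h t / (sin t)\<^sup>2) (at t)"
    unfolding crit_slope_def[abs_def] h_def
    by (rule derivative_eq_intros refl | use pos in \<open>simp add: power2_eq_square\<close>)+
  moreover have "h t \<le> h 0"
  proof (rule DERIV_nonpos_imp_nonincreasing[of 0 t h])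
    fix s assume s: "0 \<le> s" "s \<le> t"
    have "real n * s \<le> real n * t"
      using s by (intro mult_left_mono) auto
    with s pos have "sin (real n * s) \<ge> 0" "sin s \<ge> 0"
      by (auto intro!: sin_ge_zero)
    moreover have "(h has_real_derivative (1 - (real n)\<^sup>2) * (sin (real n * s) * sin s)) (at s)"
      unfolding h_def
      by (rule derivative_eq_intros refl)+ (simp add: power2_eq_square algebra_simps)
    moreover have "1 - (real n)\<^sup>2 \<le> 0"
      using assms by simp
    ultimately show "\<exists>y. (h has_real_derivative y) (at s) \<and> y \<le> 0"
      by (meson mult_nonneg_nonneg mult_nonpos_nonneg)
  qed (use assms in auto)
  ultimately show ?thesis
    by (intro exI[of _ "h t / (sin t)\<^sup>2"]) (auto simp: h_def intro: divide_nonpos_nonneg)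
qed

lemma crit_radius_antimono:
  assumes "n \<ge> 1" "0 < s" "s \<le> t" "t \<le> pi / real (n + 1)"
  shows "crit_radius n t \<le> crit_radius n s"
proof (rule DERIV_nonpos_imp_nonincreasing[of s t])
  fix u assume "s \<le> u" "u \<le> t"
  with assms have "u \<in> crit_angles n"
    by auto
  from crit_radius_has_nonpos_derivative[OF assms(1) this]
    show "\<exists>y. (crit_radius n has_real_derivative y) (at u) \<and> y \<le> 0" by blast
qed (use assms in auto)

text \<open>The identity $\sin(nt) - \sin((n+1)t)e^{it} = -\sin t\,e^{i(n+1)t}$, divided by $\sin(nt)$. It fixes
the argument of $1 - z$ on the curve, and this is what makes the logarithmic derivative radial.\<close>

lemma one_minus_crit_point:
  assumes "n \<ge> 1" "t \<in> crit_angles n"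
  shows "1 - of_real (crit_radius n t) * cis t = - cis (real (n + 1) * t) / of_real (crit_slope n t)"
proof -
  note pos = crit_angle_sin_pos[OF assms]
  define a b where "a = real n * t" and "b = real (n + 1) * t"
  have a: "a = b - t"
    by (simp add: a_def b_def algebra_simps)
  have "of_real (sin a) - of_real (sin b) * cis t = - of_real (sin t) * cis b"
    by (rule complex_eqI) (simp_all add: a sin_diff algebra_simps)
  moreover have "1 - of_real (sin b / sin a) * cis t = (of_real (sin a) - of_real (sin b) * cis t) / of_real (sin a)"
    using pos(2) by (simp add: a_def diff_divide_distrib)
  ultimately show ?thesis
    unfolding crit_radius_def crit_slope_def a_def[symmetric] b_def[symmetric] by simp
qed

lemma norm_one_minus_crit_point:
  assumes "n \<ge> 1" "t \<in> crit_angles n"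
  shows "norm (1 - of_real (crit_radius n t) * cis t) = 1 / crit_slope n t"
  unfolding one_minus_crit_point[OF assms] using crit_slope_pos[OF assms] by (simp add: norm_divide)

lemma crit_point_neq_1:
  assumes "n \<ge> 1" "t \<in> crit_angles n"
  shows "of_real (crit_radius n t) * cis t \<noteq> 1"
  using norm_one_minus_crit_point[OF assms] crit_slope_pos[OF assms] by auto

text \<open>By \<open>one_minus_crit_point\<close>, $-z^n/(1-z) = r^n q\,e^{-it}$, while the velocity of the curve is
$(r' + ir)e^{it}$. The angular part of the velocity contributes only to the imaginary part.\<close>

lemma crit_value_has_real_derivative:
  assumes "n \<ge> 1" "t \<in> crit_angles n" and r': "(crit_radius n has_real_derivative r') (at t)"
  shows "(crit_value n has_real_derivative crit_radius n t ^ n * crit_slope n t * r') (at t)"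
proof -
  define r q where "r = crit_radius n t" and "q = crit_slope n t"
  define w' where "w' = of_real r' * cis t + of_real r * (\<i> * cis t)"
  have q: "q > 0"
    using crit_slope_pos[OF assms(1,2)] by (simp add: q_def)
  have "((\<lambda>t. of_real (crit_radius n t) * cis t) has_vector_derivative
          of_real (crit_radius n t) * (\<i> * cis t) + of_real r' * cis t) (at t)"
    by (intro has_vector_derivative_mult has_vector_derivative_of_real r' cis_has_vector_derivative)
  hence "((\<lambda>t. of_real (crit_radius n t) * cis t) has_vector_derivative w') (at t)"
    by (simp add: w'_def r_def add.commute)
  from log_norm_factor_has_real_derivative[OF this crit_point_neq_1[OF assms(1,2)], of n]
  have "(crit_value n has_real_derivative
           Re (- ((of_real r * cis t) ^ n / (1 - of_real r * cis t)) * w')) (at t)"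
    by (simp add: crit_value_def[abs_def] r_def)
  also have "- ((of_real r * cis t) ^ n / (1 - of_real r * cis t)) * w' =
               of_real (r ^ n * q) * (cis (real n * t) * cis t / cis (real (n + 1) * t)) *
               (of_real r' + of_real r * \<i>)"
    unfolding r_def one_minus_crit_point[OF assms(1,2)]
    by (simp add: w'_def r_def q_def power_mult_distrib Complex.DeMoivre field_simps)
  also have "cis (real n * t) * cis t / cis (real (n + 1) * t) = 1"
    by (simp add: cis_mult cis_divide algebra_simps)
  finally show ?thesis
    by (simp add: r_def q_def)
qed

section \<open>Comparison with the curve on circles and rays\<close>

lemma log_norm_factor_radial_derivative:
  assumes "of_real r * cis \<phi> \<noteq> 1"
  shows "\<exists>D. ((\<lambda>r. log_norm_factor n (of_real r * cis \<phi>)) has_real_derivative D) (at r) \<and>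
             D \<le> \<bar>r\<bar> ^ n / norm (1 - of_real r * cis \<phi>)"
proof -
  define w where "w = of_real r * cis \<phi>"
  have "((\<lambda>r. of_real r * cis \<phi>) has_vector_derivative of_real r * 0 + of_real 1 * cis \<phi>) (at r)"
    by (intro has_vector_derivative_mult has_vector_derivative_of_real DERIV_ident has_vector_derivative_const)
  hence "((\<lambda>r. of_real r * cis \<phi>) has_vector_derivative cis \<phi>) (at r)"
    by simp
  from log_norm_factor_has_real_derivative[OF this assms, of n]
  have "((\<lambda>r. log_norm_factor n (of_real r * cis \<phi>)) has_real_derivative
          Re (- (w ^ n / (1 - w)) * cis \<phi>)) (at r)"
    by (simp add: w_def)
  moreover have "Re (- (w ^ n / (1 - w)) * cis \<phi>) \<le> norm (- (w ^ n / (1 - w)) * cis \<phi>)"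
    by (rule complex_Re_le_cmod)
  moreover have "norm (- (w ^ n / (1 - w)) * cis \<phi>) = \<bar>r\<bar> ^ n / norm (1 - w)"
    by (simp add: w_def norm_mult norm_divide norm_power)
  ultimately show ?thesis
    unfolding w_def by auto
qed

lemma log_norm_factor_angular_derivative:
  assumes "of_real r * cis \<phi> \<noteq> 1"
  shows "((\<lambda>\<phi>. log_norm_factor n (of_real r * cis \<phi>)) has_real_derivative
           r ^ (n + 1) * (sin (real (n + 1) * \<phi>) - r * sin (real n * \<phi>)) /
             (norm (1 - of_real r * cis \<phi>))\<^sup>2) (at \<phi>)"
proof -
  define w where "w = of_real r * cis \<phi>"
  have "((\<lambda>\<phi>. of_real r * cis \<phi>) has_vector_derivative of_real r * (\<i> * cis \<phi>) + 0 * cis \<phi>) (at \<phi>)"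
    by (intro has_vector_derivative_mult cis_has_vector_derivative has_vector_derivative_const)
  hence "((\<lambda>\<phi>. of_real r * cis \<phi>) has_vector_derivative \<i> * w) (at \<phi>)"
    by (simp add: w_def mult_ac)
  from log_norm_factor_has_real_derivative[OF this assms, of n]
  have "((\<lambda>\<phi>. log_norm_factor n (of_real r * cis \<phi>)) has_real_derivative
          Re (- (w ^ n / (1 - w)) * (\<i> * w))) (at \<phi>)"
    by (simp add: w_def)
  also have "- (w ^ n / (1 - w)) * (\<i> * w) = - (\<i> * (w ^ (n + 1) / (1 - w)))"
    by simp
  also have "Re \<dots> = Im (w ^ (n + 1) / (1 - w))"
    unfolding uminus_complex.sel by (simp only: Re_i_times minus_minus)
  also have "w ^ (n + 1) / (1 - w) = w ^ (n + 1) * cnj (1 - w) / of_real ((norm (1 - w))\<^sup>2)"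
    by (subst complex_div_cnj) simp
  also have "w ^ (n + 1) * cnj (1 - w) =
               of_real (r ^ (n + 1)) * (cis (real (n + 1) * \<phi>) - of_real r * cis (real n * \<phi>))"
  proof -
    have "w ^ (n + 1) = of_real (r ^ (n + 1)) * cis (real (n + 1) * \<phi>)"
      by (simp add: w_def power_mult_distrib Complex.DeMoivre del: of_nat_Suc power_Suc)
    moreover have "cnj (1 - w) = 1 - of_real r * cis (- \<phi>)"
      by (simp add: w_def cis_cnj)
    moreover have "cis (real (n + 1) * \<phi>) * cis (- \<phi>) = cis (real n * \<phi>)"
      by (simp add: cis_mult algebra_simps)
    ultimately have "w ^ (n + 1) * cnj (1 - w) = of_real (r ^ (n + 1)) *
        (cis (real (n + 1) * \<phi>) - of_real r * (cis (real (n + 1) * \<phi>) * cis (- \<phi>)))"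
      by (simp only: right_diff_distrib mult_1_right mult_1_left mult_ac)
    thus ?thesis
      by (simp only: \<open>cis (real (n + 1) * \<phi>) * cis (- \<phi>) = cis (real n * \<phi>)\<close>)
  qed
  also have "Im (of_real (r ^ (n + 1)) * (cis (real (n + 1) * \<phi>) - of_real r * cis (real n * \<phi>)) /
                 of_real ((norm (1 - w))\<^sup>2)) =
             r ^ (n + 1) * (sin (real (n + 1) * \<phi>) - r * sin (real n * \<phi>)) / (norm (1 - w))\<^sup>2"
    unfolding Im_divide_of_real Im_complex_of_real times_complex.sel by simp
  finally show ?thesis
    by (simp add: w_def)
qed

lemma norm_one_minus_polar_mono:
  assumes "r \<ge> 0" "0 \<le> \<psi>" "\<psi> \<le> \<phi>" "\<phi> \<le> pi"
  shows "norm (1 - of_real r * cis \<psi>) \<le> norm (1 - of_real r * cis \<phi>)"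
proof (rule power2_le_imp_le)
  have "(norm (1 - of_real r * cis x))\<^sup>2 = 1 + r\<^sup>2 - 2 * r * cos x" for x
  proof -
    have "(norm (1 - of_real r * cis x))\<^sup>2 = 1 - 2 * r * cos x + r\<^sup>2 * ((sin x)\<^sup>2 + (cos x)\<^sup>2)"
      unfolding cmod_power2 by (simp add: power2_eq_square algebra_simps del: sin_cos_squared_add3)
    thus ?thesis by simp
  qed
  moreover have "r * cos \<phi> \<le> r * cos \<psi>"
    using assms by (intro mult_left_mono cos_monotone_0_pi_le) auto
  ultimately show "(norm (1 - of_real r * cis \<psi>))\<^sup>2 \<le> (norm (1 - of_real r * cis \<phi>))\<^sup>2"
    by simp
qed auto

text \<open>At angles $\psi$ below $t$ the critical radius is at least $r(t)$, so the angular derivative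
$\sin((n+1)\psi) - r(t)\sin(n\psi)$ is nonnegative there, up to a positive factor. The point $1$
lies on this arc when the radius is $1$ and $\phi = 0$, which has to be excluded.\<close>

lemma log_norm_factor_le_crit_value_below:
  assumes n: "n \<ge> 1" and t: "t \<in> crit_angles n" and \<phi>: "0 \<le> \<phi>" "\<phi> \<le> t"
    and neq: "of_real (crit_radius n t) * cis \<phi> \<noteq> 1"
  shows "log_norm_factor n (of_real (crit_radius n t) * cis \<phi>) \<le> crit_value n t"
proof -
  define r where "r = crit_radius n t"
  have r: "r \<ge> 0"
    using crit_radius_nonneg[OF n t] by (simp add: r_def)
  have "log_norm_factor n (of_real r * cis \<phi>) \<le> log_norm_factor n (of_real r * cis t)"
  proof (rule DERIV_nonneg_imp_nondecreasing[of \<phi> t])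
    fix \<psi> assume \<psi>: "\<phi> \<le> \<psi>" "\<psi> \<le> t"
    have "norm (1 - of_real r * cis \<phi>) \<le> norm (1 - of_real r * cis \<psi>)"
      using \<phi> \<psi> r crit_angle_sin_pos(5)[OF n t] by (intro norm_one_minus_polar_mono) auto
    hence "of_real r * cis \<psi> \<noteq> 1"
      using neq by (auto simp: r_def)
    moreover have "r * sin (real n * \<psi>) \<le> sin (real (n + 1) * \<psi>)"
    proof (cases "\<psi> = 0")
      case False
      hence "\<psi> \<in> crit_angles n"
        using \<phi> \<psi> t by auto
      moreover have "r \<le> crit_radius n \<psi>"
        unfolding r_def using False \<phi> \<psi> t by (intro crit_radius_antimono n) auto
      ultimately show ?thesis
        using crit_angle_sin_pos(2)[OF n, of \<psi>] by (simp add: crit_radius_def pos_le_divide_eq)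
    qed auto
    ultimately show "\<exists>D. ((\<lambda>\<phi>. log_norm_factor n (of_real r * cis \<phi>)) has_real_derivative D) (at \<psi>) \<and> D \<ge> 0"
      using r by (intro exI[of _ "r ^ (n + 1) * (sin (real (n + 1) * \<psi>) - r * sin (real n * \<psi>)) /
             (norm (1 - of_real r * cis \<psi>))\<^sup>2"] conjI log_norm_factor_angular_derivative) auto
  qed fact
  thus ?thesis
    by (simp add: r_def crit_value_def)
qed

text \<open>The ray at angle $\phi$ and the critical curve are followed inwards together, at equal radii, by
letting $s$ run from $t$ to $\min(\phi, \pi/(n+1))$. At each radius the curve is nearer to $1$, so
$\ln|E|$ drops at least as much along it, and at the end of the range the two points coincide:
either the curve meets the ray, or both arrive at the origin.\<close>

lemma log_norm_factor_le_crit_value_above: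
  assumes n: "n \<ge> 1" and t: "t \<in> crit_angles n" and \<phi>: "t \<le> \<phi>" "\<phi> \<le> pi"
  shows "log_norm_factor n (of_real (crit_radius n t) * cis \<phi>) \<le> crit_value n t"
proof -
  define u where "u = min \<phi> (pi / real (n + 1))"
  define G where "G = (\<lambda>s. log_norm_factor n (of_real (crit_radius n s) * cis \<phi>) - crit_value n s)"
  have u: "t \<le> u" "u \<le> pi / real (n + 1)" "u \<le> \<phi>"
    using t \<phi> by (auto simp: u_def)
  have "G t \<le> G u"
  proof (rule DERIV_nonneg_imp_nondecreasing[OF u(1)])
    fix s assume s: "t \<le> s" "s \<le> u"
    have s': "s \<in> crit_angles n"
      using s t u by auto
    define r where "r = crit_radius n s"
    have r: "r \<ge> 0"
      using crit_radius_nonneg[OF n s'] by (simp add: r_def)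
    obtain r' where r': "r' \<le> 0" "(crit_radius n has_real_derivative r') (at s)"
      using crit_radius_has_nonpos_derivative[OF n s'] by blast
    have le: "1 / crit_slope n s \<le> norm (1 - of_real r * cis \<phi>)"
      unfolding norm_one_minus_crit_point[OF n s', symmetric] r_def[symmetric]
      using s s' u \<phi> r by (intro norm_one_minus_polar_mono) auto
    have pos: "crit_slope n s > 0"
      by (rule crit_slope_pos[OF n s'])
    with le have pos': "norm (1 - of_real r * cis \<phi>) > 0"
      by (meson divide_pos_pos less_le_trans zero_less_one)
    then obtain D where
      D: "((\<lambda>r. log_norm_factor n (of_real r * cis \<phi>)) has_real_derivative D) (at r)"
         "D \<le> \<bar>r\<bar> ^ n / norm (1 - of_real r * cis \<phi>)"
      using log_norm_factor_radial_derivative[of r \<phi> n] by auto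
    have "(G has_real_derivative D * r' - r ^ n * crit_slope n s * r') (at s)"
      unfolding G_def r_def
      by (intro DERIV_diff crit_value_has_real_derivative[OF n s' r'(2)]
                DERIV_chain2[OF D(1)[unfolded r_def] r'(2)])
    moreover have "D \<le> r ^ n * crit_slope n s"
    proof -
      have "1 / norm (1 - of_real r * cis \<phi>) \<le> crit_slope n s"
        using le pos pos' by (simp add: field_simps)
      hence "r ^ n * (1 / norm (1 - of_real r * cis \<phi>)) \<le> r ^ n * crit_slope n s"
        using r by (intro mult_left_mono) auto
      with D(2) r show ?thesis by simp
    qed
    hence "D * r' - r ^ n * crit_slope n s * r' \<ge> 0"
      using r'(1) by (simp add: mult_right_mono_neg)
    ultimately show "\<exists>y. (G has_real_derivative y) (at s) \<and> 0 \<le> y"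
      by blast
  qed
  also have "G u = 0"
  proof (cases "\<phi> \<le> pi / real (n + 1)")
    case True
    thus ?thesis by (simp add: u_def G_def crit_value_def)
  next
    case False
    hence "u = pi / real (n + 1)"
      by (simp add: u_def)
    thus ?thesis
      unfolding G_def crit_value_def crit_radius_end by (simp only: crit_radius_end) simp
  qed
  finally show ?thesis
    by (simp add: G_def)
qed

text \<open>Since $L' = r^n q r'$, the derivative of $L/r^{n+1}$ has the sign of $r' K$ with
$K = r^{n+1}q - (n+1)L$. In turn $K' = r^{n+1}q' \le 0$ and $K$ vanishes at the end point
$\pi/(n+1)$, so $K \ge 0$.\<close>

lemma crit_value_scaling:
  assumes n: "n \<ge> 1" and s: "0 < s" "s \<le> t" "t < pi / real (n + 1)"
  shows "crit_value n t / crit_radius n t ^ (n + 1) \<le> crit_value n s / crit_radius n s ^ (n + 1)"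
proof -
  define K where "K = (\<lambda>x. crit_radius n x ^ (n + 1) * crit_slope n x - real (n + 1) * crit_value n x)"
  have K: "K x \<ge> 0" if x: "x \<in> crit_angles n" for x
  proof -
    have "K (pi / real (n + 1)) \<le> K x"
    proof (rule DERIV_nonpos_imp_nonincreasing[of x "pi / real (n + 1)"])
      fix y assume "x \<le> y" "y \<le> pi / real (n + 1)"
      with x have y: "y \<in> crit_angles n"
        by auto
      obtain r' q' where r': "r' \<le> 0" "(crit_radius n has_real_derivative r') (at y)"
        and q': "q' \<le> 0" "(crit_slope n has_real_derivative q') (at y)"
        using crit_radius_has_nonpos_derivative[OF n y] crit_slope_has_nonpos_derivative[OF n y] by blast
      have "(K has_real_derivative crit_radius n y ^ (n + 1) * q') (at y)"
        unfolding K_def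
        by (rule derivative_eq_intros r'(2) q'(2) crit_value_has_real_derivative[OF n y r'(2)] refl)+
           (simp add: algebra_simps)
      moreover have "crit_radius n y ^ (n + 1) * q' \<le> 0"
        using crit_radius_nonneg[OF n y] q'(1) by (intro mult_nonneg_nonpos) auto
      ultimately show "\<exists>D. (K has_real_derivative D) (at y) \<and> D \<le> 0"
        by blast
    qed (use x in auto)
    moreover have "K (pi / real (n + 1)) = 0"
      unfolding K_def crit_radius_end crit_value_end by simp
    ultimately show ?thesis
      by linarith
  qed
  have pos: "crit_radius n x > 0" if "0 < x" "x < pi / real (n + 1)" for x
  proof -
    from that have "x \<in> crit_angles n" "real (n + 1) * x < pi"
      by (auto simp: field_simps)
    moreover have "real (n + 1) * x > 0"
      using that by (intro mult_pos_pos) auto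
    ultimately have "sin (real (n + 1) * x) > 0" "sin (real n * x) > 0"
      using crit_angle_sin_pos(2)[OF n] by (blast intro: sin_gt_zero)+
    thus ?thesis
      unfolding crit_radius_def by (rule divide_pos_pos)
  qed
  show ?thesis
  proof (rule DERIV_nonpos_imp_nonincreasing[OF s(2)])
    fix x assume "s \<le> x" "x \<le> t"
    with s have x: "x \<in> crit_angles n" and rx: "crit_radius n x > 0"
      by (auto intro!: pos)
    obtain r' where r': "r' \<le> 0" "(crit_radius n has_real_derivative r') (at x)"
      using crit_radius_has_nonpos_derivative[OF n x] by blast
    define r where "r = crit_radius n x"
    have "((\<lambda>x. crit_value n x / crit_radius n x ^ (n + 1)) has_real_derivative
            r' * K x / r ^ (n + 2)) (at x)"
      by (rule derivative_eq_intros r'(2) crit_value_has_real_derivative[OF n x r'(2)] refl)+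
         (use rx in \<open>simp_all add: K_def r_def field_simps\<close>)
    moreover have "r' * K x / r ^ (n + 2) \<le> 0"
      using r' K[OF x] rx by (intro divide_nonpos_nonneg mult_nonpos_nonneg) (auto simp: r_def)
    ultimately show "\<exists>y. ((\<lambda>x. crit_value n x / crit_radius n x ^ (n + 1)) has_real_derivative y) (at x) \<and> y \<le> 0"
      by blast
  qed
qed

section \<open>Bounds inside and outside the threshold circle\<close>

lemma norm_weierstrass_factor_cnj: "norm (weierstrass_factor n (cnj z)) = norm (weierstrass_factor n z)"
proof -
  have "weierstrass_factor n (cnj z) = cnj (weierstrass_factor n z)"
    by (simp add: weierstrass_factor_def exp_cnj)
  thus ?thesis by simp
qed

text \<open>By conjugation symmetry only the upper half plane matters, where the angle is in $[0,\pi]$.\<close>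

lemma norm_weierstrass_factor_polar:
  "norm (weierstrass_factor n (of_real (norm z) * cis \<bar>Arg z\<bar>)) = norm (weierstrass_factor n z)"
proof -
  have z: "z = of_real (norm z) * cis (Arg z)"
    by (metis rcis_cmod_Arg rcis_def)
  show ?thesis
  proof (cases "Arg z \<ge> 0")
    case True
    thus ?thesis using z by simp
  next
    case False
    hence "of_real (norm z) * cis \<bar>Arg z\<bar> = cnj z"
      by (subst (3) z) (simp add: cis_cnj)
    thus ?thesis by (simp add: norm_weierstrass_factor_cnj)
  qed
qed

lemma crit_radius_tendsto_0:
  assumes "n \<ge> 1"
  shows "(crit_radius n \<longlongrightarrow> 1 + 1 / real n) (at_right 0)"
proof -
  have "((\<lambda>t. sin ((x + 1) * t) / sin (x * t)) \<longlongrightarrow> 1 + 1 / x) (at_right 0)" if "x > 0" for x :: real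
    using that by (real_asymp simp: field_simps)
  from this[of "real n"] assms show ?thesis
    by (simp add: crit_radius_def[abs_def] add.commute)
qed

lemma log_norm_factor_tendsto:
  assumes "(f \<longlongrightarrow> z) F" "z \<noteq> 1"
  shows "((\<lambda>x. log_norm_factor n (f x)) \<longlongrightarrow> log_norm_factor n z) F"
proof -
  have "isCont (weierstrass_factor n) z"
    using weierstrass_factor_continuous_on[OF continuous_on_id, of UNIV n]
    by (simp add: continuous_on_eq_continuous_at)
  hence "((\<lambda>x. weierstrass_factor n (f x)) \<longlongrightarrow> weierstrass_factor n z) F"
    using assms(1) by (rule isCont_tendsto_compose)
  thus ?thesis
    using assms(2) by (intro tendsto_intros) auto
qed

text \<open>The circle through $z$ meets the critical curve at some angle $t$, by the intermediate value
theorem. There $\ln|E(z)| \le L(t)$, and $L/r^{n+1}$ at $t$ is at most its limit at angle $0$, where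
the curve reaches the real point $1 + 1/n$.\<close>

lemma log_norm_factor_inner_bound:
  assumes n: "n \<ge> 1" and z: "norm z < 1 + 1 / real n" "z \<noteq> 1"
  shows "log_norm_factor n z \<le>
           log_norm_factor n (of_real (1 + 1 / real n)) / (1 + 1 / real n) ^ (n + 1) * norm z ^ (n + 1)"
proof (cases "z = 0")
  case False
  define r1 where "r1 = 1 + 1 / real n"
  define r where "r = norm z"
  have r: "0 < r" "r < r1"
    using False z by (auto simp: r_def r1_def)
  have lim: "(crit_radius n \<longlongrightarrow> r1) (at_right 0)"
    using crit_radius_tendsto_0[OF n] by (simp add: r1_def)
  have "eventually (\<lambda>s. crit_radius n s > r \<and> s \<in> {0<..<pi / real (n + 1)}) (at_right 0)"
    using order_tendstoD(1)[OF lim r(2)]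
    by (intro eventually_conj eventually_at_right_real) (auto simp del: of_nat_Suc of_nat_add)
  then obtain s where s: "crit_radius n s > r" "0 < s" "s < pi / real (n + 1)"
    using eventually_happens' [OF trivial_limit_at_right_real] by (metis (no_types, lifting) greaterThanLessThan_iff)
  have "\<exists>t\<ge>s. t \<le> pi / real (n + 1) \<and> crit_radius n t = r"
  proof (rule IVT2')
    show "continuous_on {s..pi / real (n + 1)} (crit_radius n)"
    proof (intro continuous_at_imp_continuous_on ballI)
      fix t assume "t \<in> {s..pi / real (n + 1)}"
      with s have "t \<in> crit_angles n" by auto
      from crit_radius_has_nonpos_derivative[OF n this] show "isCont (crit_radius n) t"
        using DERIV_isCont by blast
    qed
    show "crit_radius n (pi / real (n + 1)) \<le> r"
      unfolding crit_radius_end using r by simp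
  qed (use s in auto)
  then obtain t where t: "s \<le> t" "t \<le> pi / real (n + 1)" "crit_radius n t = r"
    by blast
  with s have t': "t \<in> crit_angles n"
    by auto
  have "t \<noteq> pi / real (n + 1)"
    using crit_radius_end[of n] t(3) r by auto
  with t have t_less: "t < pi / real (n + 1)"
    by simp
  have "log_norm_factor n (of_real r * cis \<bar>Arg z\<bar>) \<le> crit_value n t"
  proof (cases "\<bar>Arg z\<bar> \<le> t")
    case True
    have "of_real r * cis \<bar>Arg z\<bar> \<noteq> 1"
      using norm_weierstrass_factor_polar[of n z] z(2) unfolding r_def
      by (metis norm_eq_zero weierstrass_factor_eq_0_iff)
    thus ?thesis
      using log_norm_factor_le_crit_value_below[OF n t', of "\<bar>Arg z\<bar>"] True t(3) by simp
  next
    case False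
    moreover have "\<bar>Arg z\<bar> \<le> pi"
      using Arg_le_pi[of z] mpi_less_Arg[of z] by linarith
    ultimately show ?thesis
      using log_norm_factor_le_crit_value_above[OF n t', of "\<bar>Arg z\<bar>"] t(3) by simp
  qed
  hence "log_norm_factor n z \<le> crit_value n t"
    by (simp add: r_def norm_weierstrass_factor_polar)
  also have "crit_value n t / r ^ (n + 1) \<le> log_norm_factor n (of_real r1) / r1 ^ (n + 1)"
  proof (rule tendsto_lowerbound)
    have "((\<lambda>s. of_real (crit_radius n s) * cis s) \<longlongrightarrow> of_real r1 * cis 0) (at_right 0)"
      by (intro tendsto_intros lim) 
    hence "((\<lambda>s. of_real (crit_radius n s) * cis s) \<longlongrightarrow> of_real r1) (at_right 0)"
      by simp
    moreover have "complex_of_real r1 \<noteq> 1" "r1 > 0"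
      using n r by (auto simp: r1_def)
    ultimately show "((\<lambda>s. crit_value n s / crit_radius n s ^ (n + 1)) \<longlongrightarrow>
            log_norm_factor n (of_real r1) / r1 ^ (n + 1)) (at_right 0)"
      unfolding crit_value_def by (intro tendsto_intros lim log_norm_factor_tendsto) auto
    have "eventually (\<lambda>s. s \<in> {0<..<t}) (at_right 0)"
      using t s by (intro eventually_at_right_real) auto
    thus "eventually (\<lambda>s. crit_value n t / r ^ (n + 1) \<le> crit_value n s / crit_radius n s ^ (n + 1)) (at_right 0)"
      by eventually_elim (use crit_value_scaling[OF n _ _ t_less] t(3) in auto)
  qed auto
  hence "crit_value n t \<le> log_norm_factor n (of_real r1) / r1 ^ (n + 1) * r ^ (n + 1)"
    using r by (simp add: pos_divide_le_eq)
  finally show ?thesis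
    by (simp add: r_def r1_def)
qed auto

text \<open>The inner bound passes to the limit along each ray, and on the threshold circle its right-hand side
equals the value at the real point.\<close>

lemma log_norm_factor_threshold_circle:
  assumes n: "n \<ge> 1"
  shows "log_norm_factor n (of_real (1 + 1 / real n) * cis \<phi>) \<le> log_norm_factor n (of_real (1 + 1 / real n))"
proof -
  define r1 where "r1 = 1 + 1 / real n"
  define c where "c = log_norm_factor n (of_real r1) / r1 ^ (n + 1)"
  have r1: "r1 > 1"
    using n by (simp add: r1_def)
  have "log_norm_factor n (of_real r1 * cis \<phi>) \<le> c * r1 ^ (n + 1)"
  proof (rule tendsto_le)
    show "((\<lambda>r. c * r ^ (n + 1)) \<longlongrightarrow> c * r1 ^ (n + 1)) (at_left r1)"
      by (intro tendsto_intros)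
    have "norm (of_real r1 * cis \<phi>) \<noteq> norm (1 :: complex)"
      using r1 by (simp add: norm_mult)
    hence "of_real r1 * cis \<phi> \<noteq> 1"
      by metis
    thus "((\<lambda>r. log_norm_factor n (of_real r * cis \<phi>)) \<longlongrightarrow> log_norm_factor n (of_real r1 * cis \<phi>)) (at_left r1)"
      by (intro log_norm_factor_tendsto tendsto_intros)
    have "eventually (\<lambda>r. r \<in> {1<..<r1}) (at_left r1)"
      using r1 by (intro eventually_at_left_real) auto
    thus "eventually (\<lambda>r. log_norm_factor n (of_real r * cis \<phi>) \<le> c * r ^ (n + 1)) (at_left r1)"
    proof eventually_elim
      case (elim r)
      have nz: "norm (of_real r * cis \<phi>) = r"
        using elim by (simp add: norm_mult)
      have "of_real r * cis \<phi> \<noteq> 1"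
        using nz elim by force
      thus ?case
        using log_norm_factor_inner_bound[OF n, of "of_real r * cis \<phi>"] elim nz
        by (simp add: c_def r1_def)
    qed
  qed auto
  also have "c * r1 ^ (n + 1) = log_norm_factor n (of_real r1)"
    using r1 by (simp add: c_def)
  finally show ?thesis
    by (simp only: r1_def)
qed

lemma log_norm_factor_real_derivative:
  assumes "r > 1"
  shows "((\<lambda>r. log_norm_factor n (of_real r)) has_real_derivative r ^ n / (r - 1)) (at r)"
proof -
  have "(complex_of_real has_vector_derivative of_real 1) (at r)"
    by (intro has_vector_derivative_of_real DERIV_ident)
  from log_norm_factor_has_real_derivative[OF this, of n]
  have "((\<lambda>r. log_norm_factor n (of_real r)) has_real_derivative
          Re (- (of_real r ^ n / (1 - of_real r)))) (at r)"
    using assms by simp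
  also have "- (complex_of_real r ^ n / (1 - of_real r)) = of_real (r ^ n / (r - 1))"
    using assms by (simp add: field_simps)
  finally show ?thesis by simp
qed

text \<open>Starting from the threshold circle, the radial growth $r^n/|1-z|$ is largest for real $z$, because
$|1-z| \ge r - 1$.\<close>

lemma log_norm_factor_outer_bound:
  assumes n: "n \<ge> 1" and z: "norm z \<ge> 1 + 1 / real n"
  shows "log_norm_factor n z \<le> log_norm_factor n (of_real (norm z))"
proof -
  define \<phi> where "\<phi> = Arg z"
  define G where "G = (\<lambda>r. log_norm_factor n (of_real r) - log_norm_factor n (of_real r * cis \<phi>))"
  have "0 \<le> G (1 + 1 / real n)"
    using log_norm_factor_threshold_circle[OF n, of \<phi>] unfolding G_def by simp
  also have "\<dots> \<le> G (norm z)"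
  proof (rule DERIV_nonneg_imp_nondecreasing[OF z])
    fix r assume "1 + 1 / real n \<le> r" "r \<le> norm z"
    moreover have "1 / real n > 0"
      using n by simp
    ultimately have r: "r > 1" by linarith
    have le: "r - 1 \<le> norm (1 - of_real r * cis \<phi>)"
      using norm_triangle_ineq2[of "of_real r * cis \<phi>" 1] r
      by (simp add: norm_mult norm_minus_commute)
    with r have "of_real r * cis \<phi> \<noteq> 1"
      by auto
    then obtain D where
      D: "((\<lambda>r. log_norm_factor n (of_real r * cis \<phi>)) has_real_derivative D) (at r)"
         "D \<le> \<bar>r\<bar> ^ n / norm (1 - of_real r * cis \<phi>)"
      using log_norm_factor_radial_derivative[of r \<phi> n] by blast
    have "(G has_real_derivative r ^ n / (r - 1) - D) (at r)"
      unfolding G_def by (intro DERIV_diff log_norm_factor_real_derivative r D)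
    moreover have "\<bar>r\<bar> ^ n / norm (1 - of_real r * cis \<phi>) \<le> r ^ n / (r - 1)"
      using le r by (simp add: frac_le)
    ultimately show "\<exists>y. (G has_real_derivative y) (at r) \<and> 0 \<le> y"
      using D(2) by (intro exI[of _ "r ^ n / (r - 1) - D"]) auto
  qed
  also have "of_real (norm z) * cis \<phi> = z"
    unfolding \<phi>_def by (metis rcis_cmod_Arg rcis_def)
  hence "G (norm z) = log_norm_factor n (of_real (norm z)) - log_norm_factor n z"
    by (simp add: G_def)
  finally show ?thesis by simp
qed

section \<open>The ratio on the real axis\<close>

lemma log_norm_factor_of_real:
  assumes "r > 1"
  shows "log_norm_factor n (of_real r) = ln (r - 1) + (\<Sum>k=1..n. r ^ k / real k)"
proof -
  have "weierstrass_factor n (of_real r) = of_real ((1 - r) * exp (\<Sum>k=1..n. r ^ k / real k))"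
    by (simp add: weierstrass_factor_def exp_of_real[symmetric])
  hence "norm (weierstrass_factor n (of_real r)) = (r - 1) * exp (\<Sum>k=1..n. r ^ k / real k)"
    using assms by (simp only: norm_of_real abs_mult) simp
  thus ?thesis
    using assms by (simp add: ln_mult)
qed

text \<open>The factor $|1-z| = 1/n$ is outweighed by the exponential, because the exponent is at least the
harmonic number $H_n \ge \ln(n+1)$.\<close>

lemma log_norm_factor_threshold_pos:
  assumes "n \<ge> 1"
  shows "log_norm_factor n (of_real (1 + 1 / real n)) > 0"
proof -
  have "ln (real n) < ln (real n + 1)"
    using assms by simp
  also have "\<dots> \<le> harm n"
    by (rule ln_le_harm)
  also have "\<dots> \<le> (\<Sum>k=1..n. (1 + 1 / real n) ^ k / real k)"
    unfolding harm_def by (intro sum_mono) (auto simp: inverse_eq_divide intro!: divide_right_mono one_le_power)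
  finally show ?thesis
    using assms by (subst log_norm_factor_of_real) (auto simp: ln_div)
qed

text \<open>The left-hand side is $\sum_{k\le n} r^k + 1/(r-1)$, and the powers $r^k$ with $k \ge 1$ have
coefficients $n/k \ge 1$ on the right. The term $n\ln(r-1) \ge 2$ pays for the remaining
$1 + 1/(r-1)$; the radius $1 + e^2$ is chosen to make this logarithm at least $2$.\<close>

lemma log_norm_factor_growth:
  assumes n: "n \<ge> 1" and r: "r \<ge> 1 + exp 2"
  shows "r ^ (n + 1) / (r - 1) \<le> real n * log_norm_factor n (of_real r)"
proof -
  have "exp 2 > (1::real)" by simp
  with r have r2: "r > 2" by linarith
  have "(r - 1) * (\<Sum>k<n + 1. r ^ k) = r ^ (n + 1) - 1"
    by (simp only: power_diff_1_eq)
  hence "r ^ (n + 1) / (r - 1) = (\<Sum>k<n + 1. r ^ k) + 1 / (r - 1)"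
    using r2 by (simp add: field_simps)
  also have "(\<Sum>k<n + 1. r ^ k) = 1 + (\<Sum>k=1..n. r ^ k)"
    by (simp add: sum.lessThan_Suc_shift sum.atLeast1_atMost_eq del: sum.lessThan_Suc)
  also have "1 + (\<Sum>k=1..n. r ^ k) + 1 / (r - 1) \<le> 2 + (\<Sum>k=1..n. r ^ k)"
    using r2 by (simp add: field_simps)
  also have "\<dots> \<le> real n * ln (r - 1) + (\<Sum>k=1..n. real n * (r ^ k / real k))"
  proof (intro add_mono sum_mono)
    have "ln (exp 2) \<le> ln (r - 1)"
      using r r2 by (subst ln_le_cancel_iff) auto
    hence "1 * 2 \<le> real n * ln (r - 1)"
      using n by (intro mult_mono) auto
    thus "2 \<le> real n * ln (r - 1)" by simp
  next
    fix k assume "k \<in> {1..n}"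
    hence "1 * r ^ k \<le> (real n / real k) * r ^ k"
      using r2 by (intro mult_right_mono) auto
    thus "r ^ k \<le> real n * (r ^ k / real k)" by simp
  qed
  also have "\<dots> = real n * log_norm_factor n (of_real r)"
    using r2 by (simp add: log_norm_factor_of_real sum_distrib_left distrib_left)
  finally show ?thesis .
qed

text \<open>With $a = n + \alpha$ and $F(r) = \ln|E(r)|$, the derivative of $F r^{-a}$ is $r^{-a-1}(r^{n+1}/(r-1) - aF)$, and
\<open>log_norm_factor_growth\<close> makes the second factor nonpositive.\<close>

lemma real_ratio_antimono_tail:
  assumes n: "n \<ge> 1" and \<alpha>: "\<alpha> \<ge> 0" and r: "1 + exp 2 \<le> r" "r \<le> r'"
  shows "log_norm_factor n (of_real r') / r' powr (real n + \<alpha>) \<le>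
         log_norm_factor n (of_real r) / r powr (real n + \<alpha>)"
proof (rule DERIV_nonpos_imp_nonincreasing[OF r(2)])
  fix x assume x: "r \<le> x" "x \<le> r'"
  define a where "a = real n + \<alpha>"
  define F where "F = log_norm_factor n (of_real x)"
  have "exp 2 > (1::real)" by simp
  with r x have x2: "x > 2" by linarith
  have *: "x ^ (n + 1) / (x - 1) \<le> real n * F"
    unfolding F_def using r x by (intro log_norm_factor_growth n) auto
  moreover have "x ^ (n + 1) / (x - 1) > 0"
    using x2 by simp
  ultimately have "real n * F > 0"
    by linarith
  hence "F > 0"
    by (simp add: zero_less_mult_iff)
  hence "real n * F \<le> a * F"
    using \<alpha> by (intro mult_right_mono) (auto simp: a_def)
  with * have "x ^ (n + 1) / (x - 1) - a * F \<le> 0"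
    by simp
  hence "x powr (- a - 1) * (x ^ (n + 1) / (x - 1) - a * F) \<le> 0"
    by (intro mult_nonneg_nonpos) auto
  moreover have "((\<lambda>r. log_norm_factor n (of_real r) * r powr (- a)) has_real_derivative
          x powr (- a - 1) * (x ^ (n + 1) / (x - 1) - a * F)) (at x)"
  proof -
    have "((\<lambda>r. r powr (- a)) has_real_derivative (- a) * x powr (- a - 1)) (at x)"
      using x2 by (intro has_real_derivative_powr) auto
    moreover have "((\<lambda>r. log_norm_factor n (of_real r)) has_real_derivative x ^ n / (x - 1)) (at x)"
      using x2 by (intro log_norm_factor_real_derivative) auto
    ultimately have "((\<lambda>r. log_norm_factor n (of_real r) * r powr (- a)) has_real_derivative
        x ^ n / (x - 1) * x powr (- a) + (- a) * x powr (- a - 1) * F) (at x)"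
      unfolding F_def by (intro DERIV_mult)
    also have "x powr (- a) = x * x powr (- a - 1)"
      using x2 powr_add[of x 1 "- a - 1"] by simp
    finally show ?thesis
      by (simp add: algebra_simps)
  qed
  moreover have "(\<lambda>r. log_norm_factor n (of_real r) / r powr (real n + \<alpha>)) =
                   (\<lambda>r. log_norm_factor n (of_real r) * r powr (- a))"
    unfolding a_def by (simp only: powr_minus divide_inverse)
  ultimately show "\<exists>y. ((\<lambda>r. log_norm_factor n (of_real r) / r powr (real n + \<alpha>)) has_real_derivative y) (at x) \<and> y \<le> 0"
    by metis
qed

lemma real_ratio_attains_max:
  assumes n: "n \<ge> 1" and \<alpha>: "\<alpha> \<ge> 0"
  shows "\<exists>r0\<ge>1 + 1 / real n. \<forall>r\<ge>1 + 1 / real n.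
           log_norm_factor n (of_real r) / r powr (real n + \<alpha>) \<le>
           log_norm_factor n (of_real r0) / r0 powr (real n + \<alpha>)"
proof -
  define f where "f = (\<lambda>r. log_norm_factor n (of_real r) / r powr (real n + \<alpha>))"
  define r1 where "r1 = 1 + 1 / real n"
  define R :: real where "R = 1 + exp 2"
  have "1 / real n \<le> 1" "1 / real n > 0"
    using n by auto
  moreover have "exp 2 > (1::real)" by simp
  ultimately have r1: "1 < r1" "r1 \<le> R"
    unfolding r1_def R_def by linarith+
  have "continuous_on {r1..R} f"
  proof (intro continuous_at_imp_continuous_on ballI)
    fix r assume "r \<in> {r1..R}"
    with r1 have r: "r > 1" by auto
    have "isCont (\<lambda>r. log_norm_factor n (of_real r)) r"
      using log_norm_factor_real_derivative[OF r] by (rule DERIV_isCont)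
    thus "isCont f r"
      unfolding f_def using r by (intro isCont_divide) (auto intro!: continuous_intros)
  qed
  then obtain r0 where r0: "r0 \<in> {r1..R}" "\<And>r. r \<in> {r1..R} \<Longrightarrow> f r \<le> f r0"
    using continuous_attains_sup[of "{r1..R}" f] r1 by auto
  have "f r \<le> f r0" if "r \<ge> r1" for r
  proof (cases "r \<le> R")
    case True
    thus ?thesis using r0 that by auto
  next
    case False
    hence "f r \<le> f R"
      unfolding f_def R_def by (intro real_ratio_antimono_tail n \<alpha>) auto
    also have "\<dots> \<le> f r0"
      using r1 by (intro r0) auto
    finally show ?thesis .
  qed
  with r0(1) show ?thesis
    unfolding f_def r1_def by auto
qed

section \<open>The growth constant\<close>

text \<open>Below the threshold circle the inner bound gives the ratio at most $c\,|z|^{1-\alpha}$, which for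
$\alpha \le 1$ and $c > 0$ is largest at the threshold radius itself. Outside it, the outer bound
applies. So the maximiser on the real axis attains the supremum over the whole plane; the
positivity of $\ln|E|$ there is what the dependence on $\alpha$ rests on.\<close>

lemma growth_const_attained:
  assumes n: "n \<ge> 1" and \<alpha>: "\<alpha> \<in> {0..1}"
  obtains r0 where
    "r0 \<ge> 1 + 1 / real n"
    "\<And>r. r \<ge> 1 + 1 / real n \<Longrightarrow>
       log_norm_factor n (of_real r) / r powr (real n + \<alpha>) \<le>
       log_norm_factor n (of_real r0) / r0 powr (real n + \<alpha>)"
    "\<And>z. z \<notin> {0, 1} \<Longrightarrow>
       growth_ratio n \<alpha> z \<le> log_norm_factor n (of_real r0) / r0 powr (real n + \<alpha>)"
    "growth_const n \<alpha> = log_norm_factor n (of_real r0) / r0 powr (real n + \<alpha>)"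
    "log_norm_factor n (of_real r0) > 0"
proof -
  define f where "f = (\<lambda>r. log_norm_factor n (of_real r) / r powr (real n + \<alpha>))"
  define r1 where "r1 = 1 + 1 / real n"
  define c where "c = log_norm_factor n (of_real r1) / r1 ^ (n + 1)"
  have r1: "r1 > 1"
    using n by (simp add: r1_def)
  have pos1: "log_norm_factor n (of_real r1) > 0"
    unfolding r1_def by (rule log_norm_factor_threshold_pos[OF n])
  obtain r0 where r0: "r0 \<ge> r1" "\<And>r. r \<ge> r1 \<Longrightarrow> f r \<le> f r0"
    using real_ratio_attains_max[OF n, of \<alpha>] \<alpha> unfolding f_def r1_def by auto
  have bound: "growth_ratio n \<alpha> z \<le> f r0" if z: "z \<notin> {0, 1}" for z
  proof (cases "norm z \<ge> r1")
    case True
    have "growth_ratio n \<alpha> z \<le> f (norm z)"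
      unfolding growth_ratio_def f_def using True
      by (intro divide_right_mono log_norm_factor_outer_bound[OF n]) (auto simp: r1_def)
    also have "\<dots> \<le> f r0"
      using True by (rule r0(2))
    finally show ?thesis .
  next
    case False
    have quot: "x ^ (n + 1) / x powr (real n + \<alpha>) = x powr (1 - \<alpha>)" if "x > 0" for x :: real
    proof -
      have "x ^ (n + 1) = x powr real (n + 1)"
        using that by (simp add: powr_realpow del: of_nat_Suc of_nat_add)
      thus ?thesis
        by (simp add: powr_diff[symmetric])
    qed
    have "log_norm_factor n z \<le> c * norm z ^ (n + 1)"
      using log_norm_factor_inner_bound[OF n, of z] False z by (simp only: c_def r1_def) simp
    hence "growth_ratio n \<alpha> z \<le> c * norm z ^ (n + 1) / norm z powr (real n + \<alpha>)"
      unfolding growth_ratio_def by (intro divide_right_mono) auto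
    also have "\<dots> = c * norm z powr (1 - \<alpha>)"
      using quot[of "norm z"] z by (simp only: times_divide_eq_right[symmetric]) simp
    also have "\<dots> \<le> c * r1 powr (1 - \<alpha>)"
      using pos1 r1 False \<alpha> by (intro mult_left_mono powr_mono2) (auto simp: c_def)
    also have "\<dots> = f r1"
      using r1 by (simp add: c_def f_def flip: quot)
    also have "\<dots> \<le> f r0"
      by (rule r0(2)) simp
    finally show ?thesis .
  qed
  have "growth_ratio n \<alpha> (of_real r0) = f r0"
    using r0(1) r1 by (simp add: growth_ratio_def f_def)
  moreover have "complex_of_real r0 \<in> UNIV - {0, 1}"
    using r0(1) r1 by auto
  ultimately have "f r0 \<in> growth_ratio n \<alpha> ` (UNIV - {0, 1})"
    by (metis imageI)
  hence "growth_const n \<alpha> = f r0"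
    unfolding growth_const_def using bound by (intro cSup_eq_maximum) auto
  moreover have "f r0 > 0"
  proof -
    have "0 < f r1"
      using pos1 r1 by (simp add: f_def)
    also have "\<dots> \<le> f r0"
      by (rule r0(2)) simp
    finally show ?thesis .
  qed
  hence "log_norm_factor n (of_real r0) > 0"
    by (simp add: f_def zero_less_divide_iff split: if_splits)
  ultimately show ?thesis
    using that r0 bound unfolding f_def r1_def by blast
qed

theorem corollary1:
  fixes n :: nat
  assumes "n \<ge> 1"
  shows "(\<forall>\<alpha>\<in>{0..1}.
            bdd_above (growth_ratio n \<alpha> ` (UNIV - {0, 1})) \<and>
            (\<exists>r\<^sub>0::real. r\<^sub>0 \<ge> 1 + 1 / real n \<and>
               (\<forall>r::real. r \<ge> 1 + 1 / real n \<longrightarrow>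
                  ln (norm (weierstrass_factor n (of_real r))) / r powr (real n + \<alpha>)
                  \<le> ln (norm (weierstrass_factor n (of_real r\<^sub>0))) / r\<^sub>0 powr (real n + \<alpha>)) \<and>
               growth_const n \<alpha> =
                 ln (norm (weierstrass_factor n (of_real r\<^sub>0))) / r\<^sub>0 powr (real n + \<alpha>))) \<and>
         antimono_on {0..1} (growth_const n) \<and>
         convex_on {0..1} (growth_const n)"
proof (intro conjI ballI)
  fix \<alpha> :: real assume \<alpha>: "\<alpha> \<in> {0..1}"
  show "bdd_above (growth_ratio n \<alpha> ` (UNIV - {0, 1}))"
    by (rule growth_const_attained[OF assms \<alpha>]) (auto intro!: bdd_aboveI2)
  show "\<exists>r\<^sub>0::real. r\<^sub>0 \<ge> 1 + 1 / real n \<and>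
               (\<forall>r::real. r \<ge> 1 + 1 / real n \<longrightarrow>
                  ln (norm (weierstrass_factor n (of_real r))) / r powr (real n + \<alpha>)
                  \<le> ln (norm (weierstrass_factor n (of_real r\<^sub>0))) / r\<^sub>0 powr (real n + \<alpha>)) \<and>
               growth_const n \<alpha> =
                 ln (norm (weierstrass_factor n (of_real r\<^sub>0))) / r\<^sub>0 powr (real n + \<alpha>)"
    by (rule growth_const_attained[OF assms \<alpha>]) blast
next
  have le: "log_norm_factor n (of_real r) / r powr (real n + \<alpha>) \<le> growth_const n \<alpha>"
    if "\<alpha> \<in> {0..1}" "r \<ge> 1 + 1 / real n" for r \<alpha>
    by (rule growth_const_attained[OF assms that(1)]) (use that(2) in simp)
  have gt_1: "r > 1" if "r \<ge> 1 + 1 / real n" for r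
  proof -
    have "1 / real n > 0"
      using assms by simp
    with that show ?thesis by linarith
  qed
  (* The maximiser for the larger exponent is a competitor for the smaller one. *)
  show "antimono_on {0..1} (growth_const n)"
  proof (rule monotone_onI)
    fix \<alpha> \<beta> :: real assume *: "\<alpha> \<in> {0..1}" "\<beta> \<in> {0..1}" "\<alpha> \<le> \<beta>"
    obtain r where r: "r \<ge> 1 + 1 / real n" "log_norm_factor n (of_real r) > 0"
      "growth_const n \<beta> = log_norm_factor n (of_real r) / r powr (real n + \<beta>)"
      using growth_const_attained[OF assms *(2)] by metis
    have "r powr (real n + \<alpha>) \<le> r powr (real n + \<beta>)"
      using gt_1[OF r(1)] *(3) by (intro powr_mono) auto
    moreover have "r powr (real n + \<alpha>) > 0"
      using gt_1[OF r(1)] by simp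
    ultimately have "growth_const n \<beta> \<le> log_norm_factor n (of_real r) / r powr (real n + \<alpha>)"
      unfolding r(3) using r(2) by (intro frac_le) auto
    also have "\<dots> \<le> growth_const n \<alpha>"
      by (intro le * r)
    finally show "growth_const n \<alpha> \<ge> growth_const n \<beta>" .
  qed
  (* The maximiser r for the intermediate exponent is a competitor at both ends,
     and for fixed r the ratio is an exponential of an affine function of the exponent. *)
  show "convex_on {0..1} (growth_const n)"
  proof (rule convex_onI)
    fix t \<alpha> \<beta> :: real
    assume t: "0 < t" "t < 1" and \<alpha>: "\<alpha> \<in> {0..1}" and \<beta>: "\<beta> \<in> {0..1}"
    define \<gamma> where "\<gamma> = (1 - t) *\<^sub>R \<alpha> + t *\<^sub>R \<beta>"
    have \<gamma>: "\<gamma> \<in> {0..1}"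
      unfolding \<gamma>_def using t \<alpha> \<beta> by (intro convexD) (auto simp: convex_real_interval)
    obtain r where r: "r \<ge> 1 + 1 / real n" "log_norm_factor n (of_real r) > 0"
      "growth_const n \<gamma> = log_norm_factor n (of_real r) / r powr (real n + \<gamma>)"
      using growth_const_attained[OF assms \<gamma>] by metis
    define F where "F = log_norm_factor n (of_real r)"
    define e where "e = (\<lambda>x. - ((real n + x) * ln r))"
    have F: "F / r powr (real n + x) = F * exp (e x)" for x
      using gt_1[OF r(1)] by (simp add: powr_def e_def exp_minus divide_inverse)
    have "exp (e \<gamma>) = exp ((1 - t) *\<^sub>R e \<alpha> + t *\<^sub>R e \<beta>)"
      by (simp add: e_def \<gamma>_def algebra_simps)
    also have "\<dots> \<le> (1 - t) * exp (e \<alpha>) + t * exp (e \<beta>)"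
      using t by (intro convex_onD[OF exp_convex]) auto
    finally have "F * exp (e \<gamma>) \<le> F * ((1 - t) * exp (e \<alpha>) + t * exp (e \<beta>))"
      using r(2) by (intro mult_left_mono) (auto simp: F_def)
    also have "\<dots> = (1 - t) * (F / r powr (real n + \<alpha>)) + t * (F / r powr (real n + \<beta>))"
      unfolding F by (simp add: algebra_simps)
    also have "\<dots> \<le> (1 - t) * growth_const n \<alpha> + t * growth_const n \<beta>"
      unfolding F_def using t by (intro add_mono mult_left_mono le \<alpha> \<beta> r(1)) auto
    finally show "growth_const n ((1 - t) *\<^sub>R \<alpha> + t *\<^sub>R \<beta>) \<le> (1 - t) * growth_const n \<alpha> + t * growth_const n \<beta>"
      using F[of \<gamma>] r(3) unfolding \<gamma>_def[symmetric] by (simp add: F_def)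
  qed (simp add: convex_real_interval)
qed

end
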